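(* Let $\mathcal H$ be a real Hilbert space, let $\Phi:\mathcal H\to\mathbb R$ be convex and continuously differentiable, let $\alpha>0$ and $t_0>0$, and suppose $x:[t_0,+\infty[\to\mathcal H$ is a solution of $$\ddot x(t)+\frac{\alpha}{t}\dot x(t)+\nabla\Phi(x(t))=0 .$$ For $t\ge t_0$ let $W(t)=\frac12\|\dot x(t)\|^2+\Phi(x(t))$, and for $z\in\mathcal H$ let $h_z(t)=\frac12\|x(t)-z\|^2$. Then: (i) $\lim_{t\to+\infty}W(t)=\lim_{t\to+\infty}\Phi(x(t))=\inf\Phi\in\mathbb R\cup\{-\infty\}$ (both limits exist in $\mathbb R\cup\{-\infty\}$). (ii) As $t\to+\infty$, every weak limit point of $x(t)$ lies in $\operatorname{argmin}\Phi$. (iii) If $\operatorname{argmin}\Phi=\emptyset$, then $\lim_{t\to+\infty}\|x(t)\|=+\infty$. (iv) If $x$ is bounded, then $\operatorname{argmin}\Phi\neq\emptyset$. (v) If $\Phi$ is bounded from below, then $\lim_{t\to+\infty}\|\dot x(t)\|=0$. (vi) If $\Phi$ is bounded from below and $x$ is bounded, then $\lim_{t\to+\infty}\dot h_z(t)=0$ for each $z\in\mathcal H$. Moreover, $$\int_{t_0}^{\infty}\frac1t\big(\Phi(x(t))-\min\Phi\big)\,dt<+\infty .$$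
   Context: A solution on $[t_0,+\infty[$ is a twice continuously differentiable function $x:[t_0,+\infty[\to\mathcal H$ satisfying the equation for all $t\ge t_0$. $\operatorname{argmin}\Phi=\{z\in\mathcal H:\Phi(z)=\inf\Phi\}$ denotes the set of global minimizers. In (vi), the integral estimate introduced by "Moreover" is asserted assuming that $\Phi$ is bounded from below and $x$ is bounded. *)

theory Defs
  imports "HOL-Analysis.Analysis"
begin

text \<open>The set of global minimizers. The infimum is taken in the extended reals, so that the set
  is empty when \<open>f\<close> is unbounded below.\<close>

definition argmin_set :: "('a \<Rightarrow> real) \<Rightarrow> 'a set" where
  "argmin_set f = {z. ereal (f z) = (INF y. ereal (f y))}"

definition weak_topology :: "'a::real_normed_vector topology" where
  "weak_topology = topology_generated_by {f -` U |(f :: 'a \<Rightarrow> real) U. bounded_linear f \<and> open U}"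

text \<open>Limit points are understood topologically (equivalently, through subnets). In particular,
  the weak limit of \<open>x (s n)\<close> for any sequence \<open>s n\<close> tending to infinity is a weak limit point.\<close>

definition weak_limit_point_at_top :: "(real \<Rightarrow> 'a::real_normed_vector) \<Rightarrow> 'a \<Rightarrow> bool" where
  "weak_limit_point_at_top x z \<longleftrightarrow>
     (\<forall>U. openin weak_topology U \<and> z \<in> U \<longrightarrow> (\<exists>\<^sub>F t in at_top. x t \<in> U))"

text \<open>\<open>C2_on S x x' x''\<close>: the curve \<open>x\<close> is twice continuously differentiable on \<open>S\<close> with
  derivatives \<open>x'\<close> and \<open>x''\<close>, taken within \<open>S\<close> (so one-sided at a boundary point).\<close>

definition C2_on ::
  "real set \<Rightarrow> (real \<Rightarrow> 'a::real_normed_vector) \<Rightarrow> (real \<Rightarrow> 'a) \<Rightarrow> (real \<Rightarrow> 'a) \<Rightarrow> bool" where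
  "C2_on S x x' x'' \<longleftrightarrow>
     (\<forall>t\<in>S. (x has_vector_derivative x' t) (at t within S)) \<and>
     (\<forall>t\<in>S. (x' has_vector_derivative x'' t) (at t within S)) \<and>
     continuous_on S x''"

definition energy ::
  "('a::real_normed_vector \<Rightarrow> real) \<Rightarrow> (real \<Rightarrow> 'a) \<Rightarrow> (real \<Rightarrow> 'a) \<Rightarrow> real \<Rightarrow> real" where
  "energy \<Phi> x x' t = 1 / 2 * (norm (x' t))\<^sup>2 + \<Phi> (x t)"

definition half_sq_dist :: "(real \<Rightarrow> 'a::real_normed_vector) \<Rightarrow> 'a \<Rightarrow> real \<Rightarrow> real" where
  "half_sq_dist x z t = 1 / 2 * (norm (x t - z))\<^sup>2"

end

theory Submission
  imports Defs
begin

text \<open>Everything follows from one Lyapunov function. By convexity,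
  \<open>h\<^sub>z'' + (\<alpha> / t) h\<^sub>z' + W - \<Phi> z \<le> 3/2 \<parallel>x'\<parallel>\<^sup>2\<close>, while \<open>\<parallel>x'\<parallel>\<^sup>2 / t = - W' / \<alpha>\<close>. Dividing by \<open>t\<close> and
  completing to a derivative shows that
  \<open>L\<^sub>z = - h\<^sub>z' / t - (\<alpha> + 1) h\<^sub>z / t\<^sup>2 - 3 W / (2 \<alpha>)\<close> satisfies \<open>L\<^sub>z' \<ge> (W - \<Phi> z) / t\<close>.
  If \<open>W\<close> stayed above \<open>\<Phi> z + \<epsilon>\<close>, then \<open>L\<^sub>z\<close> would grow at least like \<open>\<epsilon> ln t\<close>, forcing
  \<open>h\<^sub>z' \<le> -1\<close> eventually, which is impossible for \<open>h\<^sub>z \<ge> 0\<close>; hence the nonincreasing \<open>W\<close> tends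
  to \<open>inf \<Phi>\<close>. If \<open>x\<close> is bounded and \<open>z\<close> is a minimizer, \<open>L\<^sub>z\<close> is bounded and nondecreasing, so
  \<open>L\<^sub>z'\<close> is an integrable majorant of \<open>(\<Phi> (x t) - min \<Phi>) / t\<close>.\<close>

section \<open>Convex minimization on bounded closed convex sets, and the gradient
  inequality\<close>

text \<open>In place of weak compactness: points of nearly minimal norm in the \<open>C n\<close> form a Cauchy
  sequence by the parallelogram identity.\<close>

lemma nested_closed_convex_bounded_Inter_nonempty:
  fixes C :: "nat \<Rightarrow> 'a::{real_inner, complete_space} set"
  assumes "\<And>n. C n \<noteq> {}" "\<And>n. closed (C n)" "\<And>n. convex (C n)" "bounded (C 0)" "decseq C"
  shows "(\<Inter>n. C n) \<noteq> {}"
proof -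
  \<comment> \<open>\<open>d n\<close> is the distance from the origin to \<open>C n\<close>. It
    increases, since the sets shrink, and is bounded by any norm bound for \<open>C 0\<close>, hence
    converges.\<close>
  define d where "d n = (INF y\<in>C n. norm y)" for n
  have bdd: "bdd_below (norm ` C n)" for n
    by (rule bdd_belowI[of _ 0]) auto
  have sub: "C m \<subseteq> C n" if "n \<le> m" for n m
    using assms(5) that by (simp add: decseq_def)
  have d_le: "d n \<le> norm y" if "y \<in> C n" for n y
    unfolding d_def using bdd that by (rule cINF_lower)
  have d_nonneg: "0 \<le> d n" for n
    unfolding d_def using assms(1) by (intro cINF_greatest) auto
  have "incseq d"
    unfolding incseq_def d_def using assms(1) bdd sub by (intro allI impI cINF_superset_mono) auto
  obtain R where R: "\<And>y. y \<in> C 0 \<Longrightarrow> norm y \<le> R"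
    using assms(4) by (auto simp: bounded_iff)
  have d_le_R: "d n \<le> R" for n
    using assms(1)[of n] d_le[of _ n] sub[of 0 n] R by (meson ex_in_conv order_trans subsetD zero_le)
  obtain l where l: "d \<longlonglongrightarrow> l" "\<And>n. d n \<le> l"
    using incseq_convergent[OF \<open>incseq d\<close>] d_le_R by blast
  have "\<exists>y\<in>C n. norm y < d n + 1 / real (Suc n)" for n
    using cINF_less_iff[OF assms(1) bdd, of n "d n + 1 / real (Suc n)"] by (simp add: d_def)
  then obtain p where p: "\<And>n. p n \<in> C n" "\<And>n. norm (p n) < d n + 1 / real (Suc n)"
    by metis
  \<comment> \<open>This is what the parallelogram identity leaves: both norms are at most
    \<open>l + 1 / real (Suc n)\<close>, and the midpoint of \<open>p n\<close> and
    \<open>p m\<close> lies in the convex set \<open>C n\<close>, so \<open>norm (p n + p m)\<close>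
    is at least \<open>2 * d n\<close>.\<close>
  define u where "u n = 4 * ((l + 1 / real (Suc n))\<^sup>2 - (d n)\<^sup>2)" for n
  have key: "(norm (p n - p m))\<^sup>2 \<le> u n" if "n \<le> m" for n m
  proof -
    have "(1 / 2) *\<^sub>R p n + (1 / 2) *\<^sub>R p m \<in> C n"
      using p(1)[of n] p(1)[of m] sub[OF that] assms(3)[of n] by (intro convexD) auto
    then have "d n \<le> norm ((1 / 2) *\<^sub>R (p n + p m))"
      using d_le by (simp add: scaleR_add_right)
    then have "(2 * d n)\<^sup>2 \<le> (norm (p n + p m))\<^sup>2"
      using d_nonneg[of n] by (intro power_mono) auto
    moreover have "(norm (p n))\<^sup>2 \<le> (l + 1 / real (Suc n))\<^sup>2"
      using p(2)[of n] l(2)[of n] by (intro power_mono) auto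
    moreover have "1 / real (Suc m) \<le> 1 / real (Suc n)"
      using that by (simp add: frac_le)
    then have "(norm (p m))\<^sup>2 \<le> (l + 1 / real (Suc n))\<^sup>2"
      using p(2)[of m] l(2)[of m] by (intro power_mono) auto
    moreover have "(norm (p n - p m))\<^sup>2 + (norm (p n + p m))\<^sup>2
        = 2 * (norm (p n))\<^sup>2 + 2 * (norm (p m))\<^sup>2"
      by (simp add: power2_norm_eq_inner inner_diff inner_add inner_commute)
    ultimately show ?thesis
      unfolding u_def by (simp add: power_mult_distrib)
  qed
  have "(\<lambda>n. 4 * ((l + 1 / real (Suc n))\<^sup>2 - (d n)\<^sup>2)) \<longlonglongrightarrow> 4 * ((l + 0)\<^sup>2 - l\<^sup>2)"
    by (intro tendsto_intros l(1) LIMSEQ_Suc[OF lim_1_over_n])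
  then have "u \<longlonglongrightarrow> 0"
    by (simp add: u_def[abs_def])
  have "Cauchy p"
  proof (rule metric_CauchyI)
    fix e :: real assume "e > 0"
    then have "\<forall>\<^sub>F n in sequentially. u n < (e / 2)\<^sup>2"
      using order_tendstoD(2)[OF \<open>u \<longlonglongrightarrow> 0\<close>] by simp
    then obtain N where "u N < (e / 2)\<^sup>2"
      by (auto simp: eventually_sequentially)
    then have "norm (p N - p m) < e / 2" if "N \<le> m" for m
      using key[OF that] \<open>e > 0\<close> by (intro power2_less_imp_less[of _ "e / 2"]) auto
    then have "dist (p m) (p n) < e" if "N \<le> m" "N \<le> n" for m n
      using that dist_triangle_half_r[of "p N" "p m" e "p n"] by (simp add: dist_norm)
    then show "\<exists>N. \<forall>m\<ge>N. \<forall>n\<ge>N. dist (p m) (p n) < e" by blast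
  qed
  then obtain q where q: "p \<longlonglongrightarrow> q"
    using Cauchy_convergent_iff convergent_def by blast
  have "q \<in> C n" for n
    using assms(2) _ _ q
  proof (rule Lim_in_closed_set)
    show "\<forall>\<^sub>F m in sequentially. p m \<in> C n"
      using p(1) sub by (meson eventually_sequentially subsetD)
  qed auto
  then show ?thesis by blast
qed

text \<open>The sublevel sets along a minimizing sequence are nonempty, closed, convex, bounded and
  nested. A common point of all of them is a minimizer.\<close>

lemma convex_continuous_attains_inf:
  fixes f :: "'a::{real_inner, complete_space} \<Rightarrow> real"
  assumes f: "convex_on S f" "continuous_on S f"
    and S: "closed S" "bounded S" "S \<noteq> {}"
  shows "\<exists>p\<in>S. \<forall>y\<in>S. f p \<le> f y"
proof -
  \<comment> \<open>The infimum is taken in \<open>ereal\<close> because a lower bound of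
    \<open>f\<close> on \<open>S\<close> is not known beforehand. Monotonicity of \<open>g\<close>
    makes the sublevel sets nested.\<close>
  obtain g :: "nat \<Rightarrow> ereal" where g: "decseq g" "range g \<subseteq> (\<lambda>y. ereal (f y)) ` S"
      "(INF y\<in>S. ereal (f y)) = (INF n. g n)"
    using Inf_countable_INF[of "(\<lambda>y. ereal (f y)) ` S"] S(3) by auto
  then have "\<forall>n. \<exists>y\<in>S. g n = ereal (f y)" by blast
  then obtain v where v: "\<And>n. v n \<in> S" "\<And>n. g n = ereal (f (v n))" by metis
  define C where "C n = {y \<in> S. f y \<le> f (v n)}" for n
  have "(\<Inter>n. C n) \<noteq> {}"
  proof (rule nested_closed_convex_bounded_Inter_nonempty)
    fix n
    show "C n \<noteq> {}" using v(1) by (auto simp: C_def)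
    show "closed (C n)"
      unfolding C_def using continuous_closed_preimage[OF f(2) S(1), of "{..f (v n)}"]
      by (simp add: vimage_def Int_def)
    show "convex (C n)"
      unfolding C_def
    proof (rule convexI)
      fix y z and r s :: real
      assume "y \<in> {y \<in> S. f y \<le> f (v n)}" "z \<in> {y \<in> S. f y \<le> f (v n)}"
        and "0 \<le> r" "0 \<le> s" "r + s = 1"
      then show "r *\<^sub>R y + s *\<^sub>R z \<in> {y \<in> S. f y \<le> f (v n)}"
        using convex_lower[OF f(1), of y z r s] convexD[OF convex_on_imp_convex[OF f(1)], of y z r s]
        by auto
    qed
  next
    show "bounded (C 0)"
      by (rule bounded_subset[OF S(2)]) (auto simp: C_def)
    show "decseq C"
      using g(1) unfolding decseq_def v(2) C_def by fastforce
  qed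
  then obtain p where "p \<in> S" and p: "\<And>n. ereal (f p) \<le> g n"
    using v(2) by (auto simp: C_def)
  have "f p \<le> f y" if "y \<in> S" for y
    using INF_greatest[of UNIV "ereal (f p)" g] p INF_lower[OF that, of "\<lambda>y. ereal (f y)"] g(3)
    by (metis ereal_less_eq(3) order_trans)
  then show ?thesis using \<open>p \<in> S\<close> by blast
qed

text \<open>A minimizer \<open>p\<close> over the ball bounds \<open>f (x t)\<close> from below at
  all the recurring times in the ball. As these values tend to the global infimum,
  \<open>f p\<close> equals it. Recurrence is exactly what remains when the norm does not tend to
  infinity.\<close>

lemma convex_minimizing_frequently_imp_argmin:
  fixes f :: "'a::{real_inner, complete_space} \<Rightarrow> real"
  assumes f: "convex_on UNIV f" "continuous_on UNIV f"
    and lim: "((\<lambda>t. ereal (f (x t))) \<longlongrightarrow> (INF y. ereal (f y))) F"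
    and freq: "\<exists>\<^sub>F t in F. norm (x t) \<le> R"
  shows "argmin_set f \<noteq> {}"
proof -
  have "cball 0 R \<noteq> ({} :: 'a set)"
    using frequently_ex[OF freq] by (meson cball_eq_empty norm_ge_zero not_le order_trans)
  then have "\<exists>p\<in>cball 0 R. \<forall>y\<in>cball 0 R. f p \<le> f y"
    by (intro convex_continuous_attains_inf convex_on_subset[OF f(1)] continuous_on_subset[OF f(2)])
      auto
  then obtain p where p: "\<And>y. norm y \<le> R \<Longrightarrow> f p \<le> f y"
    unfolding Ball_def Bex_def mem_cball_0 by blast
  have "ereal (f p) \<le> (INF y. ereal (f y))"
  proof (rule ccontr)
    assume "\<not> ?thesis"
    then have "\<forall>\<^sub>F t in F. ereal (f (x t)) < ereal (f p)"
      using order_tendstoD(2)[OF lim, of "ereal (f p)"] by (simp add: not_le)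
    then obtain t where "norm (x t) \<le> R" "f (x t) < f p"
      using frequently_ex[OF frequently_eventually_conj[OF freq]] by fastforce
    then show False using p[of "x t"] by simp
  qed
  then have "p \<in> argmin_set f"
    by (auto simp: argmin_set_def intro: antisym INF_lower)
  then show ?thesis by blast
qed

text \<open>Restricted to the line through \<open>a\<close> and \<open>y\<close>, the function is
  convex in one variable and lies above its tangent at 0; the claim is read off at 1.\<close>

lemma convex_gradient_ineq:
  fixes f :: "'a::real_inner \<Rightarrow> real"
  assumes "convex_on UNIV f" "GDERIV f a :> D"
  shows "f a + inner D (y - a) \<le> f y"
proof -
  let ?g = "\<lambda>s. a + s *\<^sub>R (y - a)"
  have "convex_on UNIV (\<lambda>s::real. f (?g s))"
  proof (rule convex_onI)
    fix t u v :: real assume "0 < t" "t < 1"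
    have "?g ((1 - t) *\<^sub>R u + t *\<^sub>R v) = (1 - t) *\<^sub>R ?g u + t *\<^sub>R ?g v"
      by (simp add: algebra_simps)
    then show "f (?g ((1 - t) *\<^sub>R u + t *\<^sub>R v)) \<le> (1 - t) * f (?g u) + t * f (?g v)"
      using convex_onD[OF assms(1), of t "?g u" "?g v"] \<open>0 < t\<close> \<open>t < 1\<close> by simp
  qed simp
  moreover have "((\<lambda>s::real. f (?g s)) has_field_derivative inner D (y - a)) (at 0)"
  proof -
    have "(f has_derivative (\<lambda>h. inner h D)) (at (?g 0))"
      using assms(2) by (simp add: gderiv_def)
    moreover have "(?g has_derivative (\<lambda>s. s *\<^sub>R (y - a))) (at 0)"
      by (auto intro!: derivative_eq_intros)
    ultimately have "((\<lambda>s. f (?g s)) has_derivative (\<lambda>s. inner (s *\<^sub>R (y - a)) D)) (at 0)"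
      using diff_chain_at by (fastforce simp: o_def)
    then show ?thesis
      by (rule has_derivative_imp_has_field_derivative) (simp add: inner_commute mult.commute)
  qed
  ultimately have "inner D (y - a) * (1 - 0) \<le> f (?g 1) - f (?g 0)"
    by (intro convex_on_imp_above_tangent[where A = UNIV]) auto
  then show ?thesis by simp
qed

section \<open>Derivatives along the trajectory and dissipation of energy\<close>

locale inertial_solution =
  fixes \<Phi> :: "'a::{real_inner, complete_space} \<Rightarrow> real"
    and grad\<Phi> :: "'a \<Rightarrow> 'a"
    and x x' x'' :: "real \<Rightarrow> 'a"
    and \<alpha> t0 :: real
  assumes convex: "convex_on UNIV \<Phi>"
    and grad: "GDERIV \<Phi> y :> grad\<Phi> y"
    and continuous_grad: "continuous_on UNIV grad\<Phi>"
    and alpha_pos: "\<alpha> > 0" and t0_pos: "t0 > 0"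
    and C2: "C2_on {t0..} x x' x''"
    and ode: "t \<ge> t0 \<Longrightarrow> x'' t + (\<alpha> / t) *\<^sub>R x' t + grad\<Phi> (x t) = 0"
begin

abbreviation "W \<equiv> energy \<Phi> x x'"

abbreviation "h \<equiv> half_sq_dist x"

lemma continuous_\<Phi>: "continuous_on S \<Phi>"
  using grad unfolding gderiv_def
  by (meson continuous_at_imp_continuous_on has_derivative_continuous)

text \<open>Derivatives within \<open>{t0..}\<close> become two-sided at interior points, which is
  why the estimates below are stated for \<open>t0 < t\<close>.\<close>

lemma deriv_x: "t0 < t \<Longrightarrow> (x has_vector_derivative x' t) (at t)"
  and deriv_x': "t0 < t \<Longrightarrow> (x' has_vector_derivative x'' t) (at t)"
  using C2 at_within_interior[of t "{t0..}"] unfolding C2_on_def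
  by (metis atLeast_iff greaterThan_iff interior_real_atLeast less_imp_le)+

lemma continuous_x: "continuous_on {t0..} x"
  and continuous_x': "continuous_on {t0..} x'"
  using C2 unfolding C2_on_def
  by (auto simp: continuous_on_eq_continuous_within intro: has_vector_derivative_continuous)

lemma deriv_half_sq_dist:
  assumes "t0 < t"
  shows "(h z has_real_derivative inner (x t - z) (x' t)) (at t)"
proof -
  have "((\<lambda>t. 1 / 2 * inner (x t - z) (x t - z)) has_real_derivative inner (x t - z) (x' t)) (at t)"
    unfolding has_field_derivative_def
    using deriv_x[OF assms, unfolded has_vector_derivative_def]
    by (auto intro!: derivative_eq_intros simp: inner_commute fun_eq_iff)
  then show ?thesis
    by (simp add: half_sq_dist_def[abs_def] power2_norm_eq_inner)
qed

lemma deriv_inner: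
  assumes "t0 < t"
  shows "((\<lambda>t. inner (x t - z) (x' t)) has_real_derivative
    (norm (x' t))\<^sup>2 + inner (x t - z) (x'' t)) (at t)"
  unfolding has_field_derivative_def
  using deriv_x[OF assms, unfolded has_vector_derivative_def]
    deriv_x'[OF assms, unfolded has_vector_derivative_def]
  by (auto intro!: derivative_eq_intros simp: power2_norm_eq_inner fun_eq_iff algebra_simps)

text \<open>Pairing the equation with \<open>x' t\<close> leaves only the friction term.\<close>

lemma deriv_energy:
  assumes "t0 < t"
  shows "(W has_real_derivative - (\<alpha> / t) * (norm (x' t))\<^sup>2) (at t)"
proof -
  have "((\<lambda>t. \<Phi> (x t)) has_derivative (\<lambda>s. inner (s *\<^sub>R x' t) (grad\<Phi> (x t)))) (at t)"
    using diff_chain_at[of x _ t \<Phi>] deriv_x[OF assms] grad[of "x t"]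
    by (fastforce simp: o_def gderiv_def has_vector_derivative_def)
  then have "((\<lambda>t. 1 / 2 * inner (x' t) (x' t) + \<Phi> (x t)) has_real_derivative
      inner (x' t) (x'' t) + inner (x' t) (grad\<Phi> (x t))) (at t)"
    unfolding has_field_derivative_def
    using deriv_x'[OF assms, unfolded has_vector_derivative_def]
    by (auto intro!: derivative_eq_intros simp: inner_commute fun_eq_iff algebra_simps)
  moreover have "inner (x' t) (x'' t) + inner (x' t) (grad\<Phi> (x t)) = - (\<alpha> / t) * (norm (x' t))\<^sup>2"
    using arg_cong[OF ode[of t], of "inner (x' t)"] assms
    by (simp add: inner_add_right power2_norm_eq_inner)
  moreover have "W = (\<lambda>t. 1 / 2 * inner (x' t) (x' t) + \<Phi> (x t))"
    by (simp add: energy_def power2_norm_eq_inner fun_eq_iff)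
  ultimately show ?thesis by simp
qed

lemma \<Phi>_le_energy: "\<Phi> (x t) \<le> W t"
  by (simp add: energy_def)

lemma energy_antimono:
  assumes "t0 < s" "s \<le> t"
  shows "W t \<le> W s"
proof (rule DERIV_nonpos_imp_nonincreasing[OF assms(2)])
  fix r assume "s \<le> r"
  then show "\<exists>y. (W has_real_derivative y) (at r) \<and> y \<le> 0"
    using assms t0_pos alpha_pos
    by (intro exI[of _ "- (\<alpha> / r) * (norm (x' r))\<^sup>2"] conjI deriv_energy) auto
qed

section \<open>The Lyapunov function and the decay of the energy\<close>

text \<open>The first two summands come from integrating the terms of \<open>h z\<close> divided by
  \<open>t\<close> by parts; \<open>inner (x t - z) (x' t)\<close> is the derivative of
  \<open>h z\<close>.\<close>

definition lyap :: "'a \<Rightarrow> real \<Rightarrow> real" where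
  "lyap z t = - (inner (x t - z) (x' t) / t) - (\<alpha> + 1) * h z t / t\<^sup>2 - 3 / (2 * \<alpha>) * W t"

text \<open>The acceleration is eliminated through the equation; the last summand is the nonnegative
  remainder of the integration by parts.\<close>

definition lyap' :: "'a \<Rightarrow> real \<Rightarrow> real" where
  "lyap' z t = (1 / 2 * (norm (x' t))\<^sup>2 + inner (grad\<Phi> (x t)) (x t - z)) / t
    + 2 * (\<alpha> + 1) * h z t / t ^ 3"

text \<open>The factor \<open>\<alpha> + 1\<close> cancels all terms in
  \<open>inner (x t - z) (x' t) / t\<^sup>2\<close>: one copy comes from the quotient rule and
  \<alpha> copies from friction. The dissipation of \<open>3 / (2 * \<alpha>) * W\<close> turns the
  coefficient -1 of the squared speed into 1/2.\<close>

lemma deriv_lyap: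
  assumes "t0 < t"
  shows "(lyap z has_real_derivative lyap' z t) (at t)"
proof -
  have t: "0 < t" using assms t0_pos by simp
  have eq: "inner (x t - z) (x'' t)
      = - (\<alpha> / t) * inner (x t - z) (x' t) - inner (grad\<Phi> (x t)) (x t - z)"
    using arg_cong[OF ode[of t], of "inner (x t - z)"] assms
    by (simp add: inner_add_right inner_commute)
  note [derivative_intros] = deriv_inner[OF assms] deriv_half_sq_dist[OF assms] deriv_energy[OF assms]
  show ?thesis
    unfolding lyap_def[abs_def] lyap'_def
    by (rule derivative_eq_intros refl | (use t in simp; fail))+
      (use t alpha_pos in \<open>simp add: eq field_simps power2_eq_square power3_eq_cube\<close>)
qed

text \<open>The gradient inequality at \<open>x t\<close> supplies the potential gap, and the
  coefficient 1/2 of the squared speed completes it to \<open>W t - \<Phi> z\<close>.\<close>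

lemma lyap'_ge:
  assumes "t0 < t"
  shows "(W t - \<Phi> z) / t \<le> lyap' z t"
proof -
  have t: "0 < t" using assms t0_pos by simp
  have "\<Phi> (x t) + inner (grad\<Phi> (x t)) (z - x t) \<le> \<Phi> z"
    by (rule convex_gradient_ineq[OF convex grad])
  then have "W t - \<Phi> z \<le> 1 / 2 * (norm (x' t))\<^sup>2 + inner (grad\<Phi> (x t)) (x t - z)"
    by (simp add: energy_def inner_diff_right)
  moreover have "0 \<le> 2 * (\<alpha> + 1) * h z t / t ^ 3"
    using t alpha_pos by (simp add: half_sq_dist_def)
  ultimately show ?thesis
    unfolding lyap'_def using t by (smt (verit) divide_right_mono)
qed

text \<open>Comparison with an arbitrary point \<open>z\<close> treats a finite infimum and the
  value -\<infinity> uniformly.\<close>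

lemma energy_less:
  assumes "\<Phi> z < b"
  shows "\<exists>t>t0. W t < b"
proof (rule ccontr)
  assume "\<not> ?thesis"
  then have W: "b \<le> W t" if "t0 < t" for t
    using that by force
  define e where "e = b - \<Phi> z"
  have e: "e > 0" using assms by (simp add: e_def)
  \<comment> \<open>Starting strictly after \<open>t0\<close> makes two-sided derivatives
    available.\<close>
  define t1 where "t1 = t0 + 1"
  have t1: "t0 < t1" "0 < t1" using t0_pos by (auto simp: t1_def)
  have mono: "lyap z t1 - e * ln t1 \<le> lyap z t - e * ln t" if "t1 \<le> t" for t
  proof (rule DERIV_nonneg_imp_nondecreasing[OF that])
    fix s assume s: "t1 \<le> s"
    have "e / s \<le> lyap' z s"
      using lyap'_ge[of s z] W[of s] s t1 by (smt (verit) divide_right_mono e_def)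
    moreover have "((\<lambda>t. lyap z t - e * ln t) has_real_derivative lyap' z s - e / s) (at s)"
      using s t1 by (auto intro!: derivative_eq_intros deriv_lyap)
    ultimately show "\<exists>y. ((\<lambda>t. lyap z t - e * ln t) has_real_derivative y) (at s) \<and> 0 \<le> y"
      by (intro exI[of _ "lyap' z s - e / s"]) auto
  qed
  \<comment> \<open>\<open>k\<close> collects the constants when the monotonicity inequality is
    solved for the first term of \<open>lyap\<close>, with \<open>W\<close> replaced by its lower
    bound \<open>b\<close>.\<close>
  define k where "k = - lyap z t1 + e * ln t1 - 3 / (2 * \<alpha>) * b"
  have bound: "inner (x t - z) (x' t) / t \<le> k - e * ln t" if "t1 \<le> t" for t
  proof -
    have "3 / (2 * \<alpha>) * b \<le> 3 / (2 * \<alpha>) * W t"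
      using W[of t] that t1 alpha_pos by (intro mult_left_mono) auto
    moreover have "0 \<le> (\<alpha> + 1) * h z t / t\<^sup>2"
      using alpha_pos by (simp add: half_sq_dist_def)
    ultimately show ?thesis
      using mono[OF that] unfolding k_def lyap_def by linarith
  qed
  have "\<forall>\<^sub>F t in at_top. (k + 1) / e \<le> ln t"
    using ln_at_top by (simp add: filterlim_at_top)
  then obtain T where T: "\<And>t. T \<le> t \<Longrightarrow> (k + 1) / e \<le> ln t"
    by (auto simp: eventually_at_top_linorder)
  \<comment> \<open>The bound \<open>T\<close> makes the quotient by \<open>t\<close> at most -1;
    the maximum with 1 lets this survive multiplication by \<open>t\<close>.\<close>
  define t2 where "t2 = max (max T t1) 1"
  have slope: "inner (x t - z) (x' t) \<le> - 1" if "t2 \<le> t" for t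
  proof -
    have t: "T \<le> t" "t1 \<le> t" "1 \<le> t" using that by (auto simp: t2_def)
    then have "inner (x t - z) (x' t) / t \<le> - 1"
    proof -
      have "k + 1 \<le> e * ln t"
        using T[OF t(1)] e by (simp add: pos_divide_le_eq mult.commute)
      then show ?thesis using bound[OF t(2)] by linarith
    qed
    then show ?thesis using t by (simp add: field_simps)
  qed
  \<comment> \<open>With slope at most -1, a time span of \<open>h z t2 + 1\<close> is long enough
    to push \<open>h z\<close> down to -1.\<close>
  have "h z (t2 + h z t2 + 1) + (t2 + h z t2 + 1) \<le> h z t2 + t2"
  proof (rule DERIV_nonpos_imp_nonincreasing[of t2 _ "\<lambda>t. h z t + t"])
    show "t2 \<le> t2 + h z t2 + 1" by (simp add: half_sq_dist_def)
    fix t assume t: "t2 \<le> t"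
    then have "t0 < t" using t1 by (simp add: t2_def)
    then show "\<exists>y. ((\<lambda>t. h z t + t) has_real_derivative y) (at t) \<and> y \<le> 0"
      using slope[OF t] DERIV_add[OF deriv_half_sq_dist DERIV_ident]
      by (intro exI[of _ "inner (x t - z) (x' t) + 1"]) auto
  qed
  then have "h z (t2 + h z t2 + 1) \<le> - 1" by simp
  moreover have "0 \<le> h z (t2 + h z t2 + 1)" by (simp add: half_sq_dist_def)
  ultimately show False by linarith
qed

section \<open>Limits of energy and potential in the extended reals\<close>

lemma INF_le_energy: "(INF y. ereal (\<Phi> y)) \<le> ereal (W t)"
  by (rule INF_lower2[of "x t"]) (auto simp: \<Phi>_le_energy)

text \<open>The lower estimate is immediate from \<open>INF_le_energy\<close>. For the upper one,
  \<open>energy_less\<close> provides a single time and \<open>energy_antimono\<close> keeps the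
  energy small afterwards.\<close>

lemma energy_tendsto: "((\<lambda>t. ereal (W t)) \<longlongrightarrow> (INF y. ereal (\<Phi> y))) at_top"
proof (rule order_tendstoI)
  fix a :: ereal assume "a < (INF y. ereal (\<Phi> y))"
  then show "\<forall>\<^sub>F t in at_top. a < ereal (W t)"
    using INF_le_energy by (auto intro: always_eventually less_le_trans)
next
  fix a :: ereal assume "(INF y. ereal (\<Phi> y)) < a"
  then obtain z where "ereal (\<Phi> z) < a"
    by (auto simp: INF_less_iff)
  then obtain b where b: "\<Phi> z < b" "ereal b < a"
    using ereal_dense2[of "ereal (\<Phi> z)" a] by auto
  then obtain s where "t0 < s" "W s < b"
    using energy_less by blast
  then have "ereal (W t) < a" if "s \<le> t" for t
    using energy_antimono[of s t] that b(2) by (meson ereal_less_eq(3) le_less_trans less_imp_le)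
  then show "\<forall>\<^sub>F t in at_top. ereal (W t) < a"
    by (auto simp: eventually_at_top_linorder)
qed

lemma \<Phi>_tendsto: "((\<lambda>t. ereal (\<Phi> (x t))) \<longlongrightarrow> (INF y. ereal (\<Phi> y))) at_top"
  by (rule tendsto_sandwich[OF _ _ tendsto_const energy_tendsto])
    (auto intro!: always_eventually INF_lower simp: \<Phi>_le_energy)

section \<open>Weak limit points, minimizers and unbounded trajectories\<close>

text \<open>If \<open>z\<close> were not a minimizer, the gradient inequality at \<open>z\<close>
  would give a weakly open half-space around \<open>z\<close> on which \<Phi> exceeds some
  \<open>b\<close> above the infimum. The trajectory enters it at arbitrarily late times, while
  \<open>\<Phi> (x t) < b\<close> eventually.\<close>

lemma weak_limit_point_argmin:
  assumes "weak_limit_point_at_top x z"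
  shows "z \<in> argmin_set \<Phi>"
proof -
  have "ereal (\<Phi> z) \<le> (INF y. ereal (\<Phi> y))"
  proof (rule ccontr)
    assume "\<not> ?thesis"
    then obtain b where b: "(INF y. ereal (\<Phi> y)) < ereal b" "b < \<Phi> z"
      using ereal_dense2 by (metis less_ereal.simps(1) not_le)
    define U where "U = inner (grad\<Phi> z) -` {inner (grad\<Phi> z) z - (\<Phi> z - b)<..}"
    have "openin weak_topology U"
      unfolding weak_topology_def U_def using bounded_linear_inner_right open_greaterThan
      by (intro topology_generated_by_Basis) blast
    moreover have "z \<in> U" using b by (simp add: U_def)
    ultimately have "\<exists>\<^sub>F t in at_top. x t \<in> U"
      using assms by (auto simp: weak_limit_point_at_top_def)
    then obtain t where "x t \<in> U" "ereal (\<Phi> (x t)) < ereal b"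
      using frequently_ex[OF frequently_eventually_conj[OF _ order_tendstoD(2)[OF \<Phi>_tendsto b(1)]]]
      by blast
    then show False
      using convex_gradient_ineq[OF convex grad, of z "x t"] by (simp add: U_def inner_diff_right)
  qed
  then show ?thesis
    by (auto simp: argmin_set_def intro: antisym INF_lower)
qed

lemma norm_tendsto_infinity:
  assumes "argmin_set \<Phi> = {}"
  shows "filterlim (\<lambda>t. norm (x t)) at_top at_top"
  unfolding filterlim_at_top
proof (rule allI, rule ccontr)
  fix R assume "\<not> (\<forall>\<^sub>F t in at_top. R \<le> norm (x t))"
  then have "\<exists>\<^sub>F t in at_top. norm (x t) \<le> R"
    by (auto simp: not_eventually elim: frequently_elim1)
  then show False
    using convex_minimizing_frequently_imp_argmin[OF convex continuous_\<Phi> \<Phi>_tendsto] assms by blast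
qed

lemma bounded_imp_argmin_nonempty:
  assumes "bounded (x ` {t0..})"
  shows "argmin_set \<Phi> \<noteq> {}"
proof
  assume "argmin_set \<Phi> = {}"
  obtain B where B: "\<And>t. t0 \<le> t \<Longrightarrow> norm (x t) \<le> B"
    using assms by (auto simp: bounded_iff)
  have "\<forall>\<^sub>F t in at_top. t0 \<le> t \<and> B + 1 \<le> norm (x t)"
    using norm_tendsto_infinity[OF \<open>argmin_set \<Phi> = {}\<close>]
    by (intro eventually_conj eventually_ge_at_top) (auto simp: filterlim_at_top)
  then obtain t where "t0 \<le> t" "B + 1 \<le> norm (x t)"
    by (auto simp: eventually_at_top_linorder)
  then show False using B[of t] by simp
qed

section \<open>Potentials bounded from below: velocity and derivative of the squared
  distance\<close>

lemma ereal_INF_\<Phi>: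
  assumes "bdd_below (range \<Phi>)"
  shows "(INF y. ereal (\<Phi> y)) = ereal (INF y. \<Phi> y)"
  using ereal_Inf'[of "range \<Phi>"] assms by (simp add: image_image)

lemma energy_tendsto_real:
  assumes "bdd_below (range \<Phi>)"
  shows "(W \<longlongrightarrow> (INF y. \<Phi> y)) at_top"
  using energy_tendsto by (simp add: ereal_INF_\<Phi>[OF assms] lim_ereal)

text \<open>The speed is \<open>sqrt (2 * (W t - \<Phi> (x t)))\<close>, and both terms of the
  difference have the same finite limit.\<close>

lemma velocity_tendsto_0:
  assumes "bdd_below (range \<Phi>)"
  shows "((\<lambda>t. norm (x' t)) \<longlongrightarrow> 0) at_top"
proof -
  have "((\<lambda>t. \<Phi> (x t)) \<longlongrightarrow> (INF y. \<Phi> y)) at_top"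
    using \<Phi>_tendsto by (simp add: ereal_INF_\<Phi>[OF assms] lim_ereal)
  from tendsto_diff[OF energy_tendsto_real[OF assms] this]
  have "((\<lambda>t. sqrt (2 * (W t - \<Phi> (x t)))) \<longlongrightarrow> sqrt (2 * 0)) at_top"
    by (intro tendsto_intros) simp
  then show ?thesis by (simp add: energy_def)
qed

text \<open>By Cauchy-Schwarz, a bounded factor meets the vanishing velocity.\<close>

lemma inner_tendsto_0:
  assumes "bdd_below (range \<Phi>)" "bounded (x ` {t0..})"
  shows "((\<lambda>t. inner (x t - z) (x' t)) \<longlongrightarrow> 0) at_top"
proof -
  obtain B where B: "\<And>t. t0 \<le> t \<Longrightarrow> norm (x t) \<le> B"
    using assms by (auto simp: bounded_iff)
  show ?thesis
  proof (rule Lim_null_comparison)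
    have "norm (inner (x t - z) (x' t)) \<le> (B + norm z) * norm (x' t)" if "t0 \<le> t" for t
    proof -
      have "norm (inner (x t - z) (x' t)) \<le> norm (x t - z) * norm (x' t)"
        by (simp add: Cauchy_Schwarz_ineq2)
      also have "\<dots> \<le> (B + norm z) * norm (x' t)"
        using B[OF that] norm_triangle_ineq4[of "x t" z] by (intro mult_right_mono) auto
      finally show ?thesis .
    qed
    then show "\<forall>\<^sub>F t in at_top. norm (inner (x t - z) (x' t)) \<le> (B + norm z) * norm (x' t)"
      by (auto simp: eventually_at_top_linorder)
    show "((\<lambda>t. (B + norm z) * norm (x' t)) \<longlongrightarrow> 0) at_top"
      using tendsto_mult_right_zero[OF velocity_tendsto_0[OF assms(1)]] .
  qed
qed

lemma half_sq_dist_deriv_tendsto_0: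
  assumes "bdd_below (range \<Phi>)" "bounded (x ` {t0..})"
  shows "((\<lambda>t. vector_derivative (h z) (at t within {t0..})) \<longlongrightarrow> 0) at_top"
proof (rule Lim_transform_eventually[OF inner_tendsto_0[OF assms, of z]])
  have "inner (x t - z) (x' t) = vector_derivative (h z) (at t within {t0..})" if "t0 < t" for t
  proof -
    have "(h z has_vector_derivative inner (x t - z) (x' t)) (at t)"
      using deriv_half_sq_dist[OF that] by (simp add: has_real_derivative_iff_has_vector_derivative)
    moreover have "at t within {t0..} = at t"
      using that by (intro at_within_interior) auto
    ultimately show ?thesis by (simp add: vector_derivative_at)
  qed
  then show "\<forall>\<^sub>F t in at_top.
      inner (x t - z) (x' t) = vector_derivative (h z) (at t within {t0..})"
    by (rule eventually_mono[OF eventually_gt_at_top])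
qed

section \<open>The integral estimate\<close>

lemma integrable_gap:
  assumes "bdd_below (range \<Phi>)" "bounded (x ` {t0..})"
  shows "set_integrable lborel {t0..} (\<lambda>t. 1 / t * (\<Phi> (x t) - (INF y. \<Phi> y)))"
proof -
  let ?m = "INF y. \<Phi> y"
  let ?g = "\<lambda>t. 1 / t * (\<Phi> (x t) - ?m)"
  \<comment> \<open>For a minimizer \<open>z\<close>, \<open>lyap' z\<close> dominates the
    nonnegative integrand \<open>?g\<close>, so it is itself nonnegative.\<close>
  obtain z where "z \<in> argmin_set \<Phi>"
    using bounded_imp_argmin_nonempty[OF assms(2)] by blast
  then have z: "\<Phi> z = ?m"
    by (simp add: argmin_set_def ereal_INF_\<Phi>[OF assms(1)])
  have m_le: "?m \<le> \<Phi> y" for y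
    using assms(1) by (rule cINF_lower) simp
  have g_nonneg: "0 \<le> ?g t" if "t0 \<le> t" for t
    using m_le[of "x t"] that t0_pos by simp
  have g_le: "?g t \<le> lyap' z t" if "t0 < t" for t
  proof -
    have "?g t \<le> (W t - \<Phi> z) / t"
      using \<Phi>_le_energy[of t] that t0_pos z by (simp add: divide_right_mono)
    then show ?thesis using lyap'_ge[OF that, of z] by simp
  qed
  have pos: "\<forall>t\<in>{t0..}. t \<noteq> 0" using t0_pos by auto
  note cont = continuous_intros continuous_x continuous_x'
    continuous_on_compose2[OF continuous_grad continuous_x]
    continuous_on_compose2[OF continuous_\<Phi>[of UNIV] continuous_x]
  have cont_lyap: "continuous_on {t0..} (lyap z)"
    unfolding lyap_def energy_def half_sq_dist_def using pos by (intro cont) auto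
  have cont_lyap': "continuous_on {t0..} (lyap' z)"
    unfolding lyap'_def half_sq_dist_def using pos by (intro cont) auto
  have cont_g: "continuous_on {t0..} ?g"
    using pos by (intro cont) auto
  have lim_t0: "(lyap z \<longlongrightarrow> lyap z t0) (at_right t0)"
    using cont_lyap unfolding continuous_on_def
    by (auto intro: tendsto_within_subset[of _ _ t0 "{t0..}"])
  \<comment> \<open>Boundedness of the trajectory makes the two distance terms vanish, leaving only
    the limit of the energy term.\<close>
  have lim_infinity: "(lyap z \<longlongrightarrow> 0 - 0 - 3 / (2 * \<alpha>) * ?m) at_top"
    unfolding lyap_def[abs_def]
  proof (intro tendsto_diff tendsto_mult tendsto_const energy_tendsto_real[OF assms(1)])
    have "((\<lambda>t. inner (x t - z) (x' t) * inverse t) \<longlongrightarrow> 0 * 0) at_top"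
      by (intro tendsto_mult inner_tendsto_0[OF assms] tendsto_inverse_0_at_top filterlim_ident)
    then show "((\<lambda>t. - (inner (x t - z) (x' t) / t)) \<longlongrightarrow> 0) at_top"
      using tendsto_minus by (fastforce simp: divide_inverse)
    obtain B where B: "\<And>t. t0 \<le> t \<Longrightarrow> norm (x t) \<le> B"
      using assms(2) by (auto simp: bounded_iff)
    have h_le: "h z t \<le> 1 / 2 * (B + norm z)\<^sup>2" if "t0 \<le> t" for t
      unfolding half_sq_dist_def using B[OF that] norm_triangle_ineq4[of "x t" z]
      by (intro mult_left_mono power_mono) auto
    show "((\<lambda>t. (\<alpha> + 1) * h z t / t\<^sup>2) \<longlongrightarrow> 0) at_top"
    proof (rule Lim_null_comparison)
      have "norm ((\<alpha> + 1) * h z t / t\<^sup>2) \<le> (\<alpha> + 1) * (1 / 2 * (B + norm z)\<^sup>2) / t\<^sup>2"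
        if "t0 \<le> t" for t
        using h_le[OF that] alpha_pos
        by (simp add: divide_right_mono half_sq_dist_def abs_mult)
      then show "\<forall>\<^sub>F t in at_top. norm ((\<alpha> + 1) * h z t / t\<^sup>2)
          \<le> (\<alpha> + 1) * (1 / 2 * (B + norm z)\<^sup>2) / t\<^sup>2"
        by (auto simp: eventually_at_top_linorder)
      show "((\<lambda>t. (\<alpha> + 1) * (1 / 2 * (B + norm z)\<^sup>2) / t\<^sup>2) \<longlongrightarrow> 0) at_top"
        by (intro tendsto_divide_0[OF tendsto_const]
            filterlim_at_top_imp_at_infinity filterlim_pow_at_top filterlim_ident) simp
    qed
  qed
  \<comment> \<open>For a nonnegative continuous derivative, finite limits of \<open>lyap z\<close>
    at both ends already give integrability.\<close>
  have "set_integrable lborel (einterval (ereal t0) \<infinity>) (lyap' z)"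
  proof (rule interval_integral_FTC_nonneg(1))
    show "(lyap z has_real_derivative lyap' z t) (at t)" if "ereal t0 < ereal t" for t
      using that by (simp add: deriv_lyap)
    show "isCont (lyap' z) t" if "ereal t0 < ereal t" for t
      using that continuous_on_interior[OF cont_lyap'] by simp
    have "0 \<le> lyap' z t" if "t0 < t" for t
      using g_le[OF that] g_nonneg[of t] that by linarith
    then show "AE t in lborel. ereal t0 < ereal t \<longrightarrow> ereal t < \<infinity> \<longrightarrow> 0 \<le> lyap' z t"
      by simp
    show "((lyap z \<circ> real_of_ereal) \<longlongrightarrow> lyap z t0) (at_right (ereal t0))"
      using lim_t0 by (simp add: ereal_tendsto_simps)
    show "((lyap z \<circ> real_of_ereal) \<longlongrightarrow> 0 - 0 - 3 / (2 * \<alpha>) * ?m) (at_left \<infinity>)"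
      using lim_infinity by (simp add: ereal_tendsto_simps)
  qed simp
  moreover have "einterval (ereal t0) \<infinity> = {t0<..}"
    by (auto simp: einterval_def)
  ultimately have "set_integrable lborel {t0<..} (lyap' z)" by simp
  then have "set_integrable lborel {t0<..} ?g"
  proof (rule set_integrable_bound)
    have "continuous_on {t0<..} ?g"
      by (rule continuous_on_subset[OF cont_g]) auto
    then show "set_borel_measurable lborel {t0<..} ?g"
      unfolding set_borel_measurable_def measurable_lborel1 measurable_lborel2
      by (intro borel_measurable_continuous_on_indicator) auto
    have "norm (?g t) \<le> norm (lyap' z t)" if "t0 < t" for t
      using g_le[OF that] g_nonneg[of t] that by (smt (verit) real_norm_def)
    then show "AE t in lborel. t \<in> {t0<..} \<longrightarrow> norm (?g t) \<le> norm (lyap' z t)"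
      by simp
  qed
  \<comment> \<open>The fundamental theorem works on the open half-line, so the endpoint is added
    separately.\<close>
  moreover have "set_integrable lborel {t0} ?g"
    unfolding set_integrable_def by (rule borel_integrable_compact) auto
  ultimately have "set_integrable lborel ({t0} \<union> {t0<..}) ?g"
    by (intro set_integrable_Un) auto
  moreover have "{t0} \<union> {t0<..} = {t0..}" by auto
  ultimately show ?thesis by simp
qed

end

section \<open>Assembly of the six claims\<close>

theorem theorem2p3:
  fixes \<Phi> :: "'a::{real_inner, complete_space} \<Rightarrow> real"
    and grad\<Phi> :: "'a \<Rightarrow> 'a"
    and x x' x'' :: "real \<Rightarrow> 'a"
    and \<alpha> t0 :: real
  assumes "convex_on UNIV \<Phi>"
    and "\<And>y. GDERIV \<Phi> y :> grad\<Phi> y"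
    and "continuous_on UNIV grad\<Phi>"
    and "\<alpha> > 0" and "t0 > 0"
    and "C2_on {t0..} x x' x''"
    and "\<And>t. t \<ge> t0 \<Longrightarrow> x'' t + (\<alpha> / t) *\<^sub>R x' t + grad\<Phi> (x t) = 0"
  shows
    "(((\<lambda>t. ereal (energy \<Phi> x x' t)) \<longlongrightarrow> (INF y. ereal (\<Phi> y))) at_top \<and>
      ((\<lambda>t. ereal (\<Phi> (x t))) \<longlongrightarrow> (INF y. ereal (\<Phi> y))) at_top \<and>
      (INF y. ereal (\<Phi> y)) \<noteq> \<infinity>) \<and>
     (\<forall>z. weak_limit_point_at_top x z \<longrightarrow> z \<in> argmin_set \<Phi>) \<and>
     (argmin_set \<Phi> = {} \<longrightarrow> filterlim (\<lambda>t. norm (x t)) at_top at_top) \<and>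
     (bounded (x ` {t0..}) \<longrightarrow> argmin_set \<Phi> \<noteq> {}) \<and>
     (bdd_below (range \<Phi>) \<longrightarrow> ((\<lambda>t. norm (x' t)) \<longlongrightarrow> 0) at_top) \<and>
     (bdd_below (range \<Phi>) \<and> bounded (x ` {t0..}) \<longrightarrow>
       (\<forall>z. ((\<lambda>t. vector_derivative (half_sq_dist x z) (at t within {t0..})) \<longlongrightarrow> 0) at_top) \<and>
       set_integrable lborel {t0..} (\<lambda>t. 1 / t * (\<Phi> (x t) - (INF y. \<Phi> y))))"
proof -
  interpret inertial_solution \<Phi> grad\<Phi> x x' x'' \<alpha> t0
    using assms by unfold_locales auto
  have "(INF y. ereal (\<Phi> y)) \<noteq> \<infinity>"
    using INF_lower[of "x t0" UNIV "\<lambda>y. ereal (\<Phi> y)"] by auto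
  then show ?thesis
    using energy_tendsto \<Phi>_tendsto weak_limit_point_argmin norm_tendsto_infinity
      bounded_imp_argmin_nonempty velocity_tendsto_0 half_sq_dist_deriv_tendsto_0 integrable_gap
    by (intro conjI allI impI) (simp_all)
qed

end
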